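(* Let $N\ge1$, let $\{\phi_j\}_{j=1}^N$ be an arbitrary orthonormal basis of $\mathbb{C}^N$, let $\Phi$ be the matrix whose $j$-th column is $\phi_j$, and let $\mathfrak{g}\in\mathbb{C}^N$. Let $c\in[0,2\pi)$, let $\alpha=(\alpha_k)_{k=1}^N\in\mathbb{C}^N$ with $\alpha_k=e^{i\left(c-\frac{2\pi(k-1)}{N}\right)}$ (here $i=\sqrt{-1}$), and let $A_\alpha=\Phi D_\alpha\Phi^*$, where $D_\alpha$ is the diagonal matrix with diagonal $\alpha$. For $m=1,\dots,N$ let $A_m\mathfrak{g}:=A_\alpha^{m-1}\mathfrak{g}$, and for $m,\ell=1,\dots,N$ define $\mathfrak{g}_{m,\ell}:=\phi_\ell\circ(A_m\mathfrak{g})$. Then for every $\mathfrak{f}\in\mathbb{C}^N$, $$A\,\|\mathfrak{f}\|_2^2\le\sum_{m=1}^N\sum_{\ell=1}^N|\langle\mathfrak{f},\mathfrak{g}_{m,\ell}\rangle|^2\le B\,\|\mathfrak{f}\|_2^2,$$ where $$A=N\cdot\min_{1\le k\le N}\sum_{j=1}^N|\phi_j(k)|^2\,|\widehat{\mathfrak{g}}(j)|^2\quad\text{and}\quad B=N\cdot\max_{1\le k\le N}\sum_{j=1}^N|\phi_j(k)|^2\,|\widehat{\mathfrak{g}}(j)|^2.$$ Moreover, the constants $A$ and $B$ are sharp (i.e. $A$ is the largest and $B$ the smallest constant for which the respective inequality holds for all $\mathfrak{f}$).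
   Context: $\widehat{\mathfrak{g}}=\Phi^*\mathfrak{g}$, i.e. $\widehat{\mathfrak g}(j)=\langle\mathfrak g,\phi_j\rangle=\sum_k\mathfrak g(k)\overline{\phi_j(k)}$. The symbol $\circ$ denotes the entrywise product, and $\phi_j(k)$ is the $k$-th entry of $\phi_j$. *)

theory Defs
  imports
    "HOL-Analysis.L2_Norm"
    "Jordan_Normal_Form.Schur_Decomposition"
begin

text \<open>
  Vectors in \<open>\<complex>\<^sup>N\<close> are elements of \<^term>\<open>carrier_vec N :: complex vec set\<close>, whose entries are
  numbered \<open>0, \<dots>, N - 1\<close>. All index sets \<open>{1, \<dots>, N}\<close> are shifted accordingly to \<open>{..<N}\<close>.
  The inner product \<open>\<langle>v, w\<rangle> = \<Sum>\<^sub>k v(k) cnj (w(k))\<close> is \<^term>\<open>v \<bullet>c w\<close>.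
\<close>

definition norm2_vec :: "complex vec \<Rightarrow> real" where
  "norm2_vec v = L2_set (\<lambda>k. cmod (v $ k)) {..<dim_vec v}"

text \<open>
  Orthonormality of an \<open>N\<close>-element family already forces it to be a basis; the basis condition is
  listed so that the predicate is literally ``orthonormal basis''.
\<close>

definition orthonormal_basis :: "nat \<Rightarrow> (nat \<Rightarrow> complex vec) \<Rightarrow> bool" where
  "orthonormal_basis N \<phi> \<longleftrightarrow>
     (\<forall>j<N. \<phi> j \<in> carrier_vec N) \<and>
     (\<forall>i<N. \<forall>j<N. \<phi> i \<bullet>c \<phi> j = (if i = j then 1 else 0)) \<and>
     vectorspace.basis class_ring (module_vec TYPE(complex) N) (\<phi> ` {..<N})"

definition basis_matrix :: "nat \<Rightarrow> (nat \<Rightarrow> complex vec) \<Rightarrow> complex mat" where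
  "basis_matrix N \<phi> = mat_of_cols N (map \<phi> [0..<N])"

definition fourier_coeffs :: "nat \<Rightarrow> (nat \<Rightarrow> complex vec) \<Rightarrow> complex vec \<Rightarrow> complex vec" where
  "fourier_coeffs N \<phi> g = mat_adjoint (basis_matrix N \<phi>) *\<^sub>v g"

definition entrywise_prod :: "complex vec \<Rightarrow> complex vec \<Rightarrow> complex vec" where
  "entrywise_prod v w = vec (dim_vec v) (\<lambda>k. v $ k * w $ k)"

text \<open>With indices starting at \<open>0\<close>, \<open>\<alpha>\<^sub>k = exp (\<i> (c - 2 \<pi> (k - 1) / N))\<close> loses the shift by one.\<close>

definition alpha :: "nat \<Rightarrow> real \<Rightarrow> complex vec" where
  "alpha N c = vec N (\<lambda>k. exp (\<i> * complex_of_real (c - 2 * pi * real k / real N)))"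

definition multiplier_matrix :: "nat \<Rightarrow> (nat \<Rightarrow> complex vec) \<Rightarrow> complex vec \<Rightarrow> complex mat" where
  "multiplier_matrix N \<phi> a =
     basis_matrix N \<phi> * mat_diag N (\<lambda>k. a $ k) * mat_adjoint (basis_matrix N \<phi>)"

text \<open>For \<open>m < N\<close> the exponent is \<open>m\<close>, again because \<open>m\<close> is numbered from \<open>0\<close>.\<close>

definition frame_vec ::
    "nat \<Rightarrow> (nat \<Rightarrow> complex vec) \<Rightarrow> real \<Rightarrow> complex vec \<Rightarrow> nat \<Rightarrow> nat \<Rightarrow> complex vec" where
  "frame_vec N \<phi> c g m l =
     entrywise_prod (\<phi> l) ((multiplier_matrix N \<phi> (alpha N c) ^\<^sub>m m) *\<^sub>v g)"

definition frame_sum ::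
    "nat \<Rightarrow> (nat \<Rightarrow> complex vec) \<Rightarrow> real \<Rightarrow> complex vec \<Rightarrow> complex vec \<Rightarrow> real" where
  "frame_sum N \<phi> c g f = (\<Sum>m<N. \<Sum>l<N. (cmod (f \<bullet>c frame_vec N \<phi> c g m l))\<^sup>2)"

definition weight :: "nat \<Rightarrow> (nat \<Rightarrow> complex vec) \<Rightarrow> complex vec \<Rightarrow> nat \<Rightarrow> real" where
  "weight N \<phi> g k = (\<Sum>j<N. (cmod (\<phi> j $ k))\<^sup>2 * (cmod (fourier_coeffs N \<phi> g $ j))\<^sup>2)"

definition lower_const :: "nat \<Rightarrow> (nat \<Rightarrow> complex vec) \<Rightarrow> complex vec \<Rightarrow> real" where
  "lower_const N \<phi> g = real N * (MIN k\<in>{..<N}. weight N \<phi> g k)"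

definition upper_const :: "nat \<Rightarrow> (nat \<Rightarrow> complex vec) \<Rightarrow> complex vec \<Rightarrow> real" where
  "upper_const N \<phi> g = real N * (MAX k\<in>{..<N}. weight N \<phi> g k)"

end

theory Submission
  imports Defs
begin

text \<open>
  The frame sum is diagonal in the standard basis: it equals \<open>N \<cdot> \<Sum>\<^sub>k |f(k)|\<^sup>2 w(k)\<close>, where
  \<open>w(k) = \<Sum>\<^sub>j |\<phi>\<^sub>j(k)|\<^sup>2 |b\<^sub>j|\<^sup>2\<close> with \<open>b\<close> the coefficient vector of \<open>g\<close>. Indeed, the sum over
  \<open>l\<close> is the squared norm of the pointwise product of \<open>f\<close> and \<open>cnj (A\<^sub>m g)\<close>, by Parseval, and
  \<open>(A\<^sub>m g)(k) = \<Sum>\<^sub>j \<alpha>\<^sub>j\<^sup>m \<phi>\<^sub>j(k) b\<^sub>j\<close>, where the vectors \<open>(\<alpha>\<^sub>j\<^sup>m)\<^sub>m\<close> are rescaled discrete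
  exponentials, so a second application of Parseval evaluates the sum over \<open>m\<close>. The optimal bounds
  of a diagonal form are its extreme weights, attained at standard basis vectors.
\<close>

section \<open>Parseval identity and discrete exponentials\<close>

text \<open>Expanding the square and summing over \<open>M\<close> first leaves only the diagonal of
  a Gram matrix. The index sets and the factor \<open>C\<close> are kept general because both sums
  of the frame sum are evaluated this way, with \<open>C = 1\<close> for \<open>l\<close> and
  \<open>C = N\<close> for \<open>m\<close>.\<close>

lemma parseval_of_orthogonal_rows:
  fixes x :: "'i \<Rightarrow> complex" and u :: "'m \<Rightarrow> 'i \<Rightarrow> complex" and C :: real
  assumes "finite I"
    and orth: "\<And>i k. i \<in> I \<Longrightarrow> k \<in> I \<Longrightarrow>
      (\<Sum>m\<in>M. u m i * cnj (u m k)) = (if i = k then complex_of_real C else 0)"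
  shows "(\<Sum>m\<in>M. (cmod (\<Sum>i\<in>I. x i * u m i))\<^sup>2) = C * (\<Sum>i\<in>I. (cmod (x i))\<^sup>2)"
proof -
  have "complex_of_real (\<Sum>m\<in>M. (cmod (\<Sum>i\<in>I. x i * u m i))\<^sup>2)
      = (\<Sum>m\<in>M. \<Sum>i\<in>I. \<Sum>k\<in>I. x i * u m i * cnj (x k * u m k))"
    by (simp add: complex_norm_square sum_product del: of_real_power)
  also have "\<dots> = (\<Sum>i\<in>I. \<Sum>k\<in>I. \<Sum>m\<in>M. x i * u m i * cnj (x k * u m k))"
    by (subst sum.swap, intro sum.cong refl, rule sum.swap)
  also have "\<dots> = (\<Sum>i\<in>I. \<Sum>k\<in>I. x i * cnj (x k) * (\<Sum>m\<in>M. u m i * cnj (u m k)))"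
    by (intro sum.cong refl) (simp add: sum_distrib_left mult_ac)
  also have "\<dots> = (\<Sum>i\<in>I. \<Sum>k\<in>I. if i = k then x i * cnj (x k) * C else 0)"
    by (intro sum.cong refl) (simp add: orth)
  also have "\<dots> = (\<Sum>i\<in>I. x i * cnj (x i) * C)"
    using \<open>finite I\<close> by simp
  also have "\<dots> = complex_of_real (C * (\<Sum>i\<in>I. (cmod (x i))\<^sup>2))"
    by (simp add: complex_norm_square sum_distrib_left mult_ac del: of_real_power)
  finally show ?thesis
    by (simp only: of_real_eq_iff)
qed

lemma alpha_nth:
  assumes "k < N"
  shows "alpha N c $ k = cis (c - 2 * pi * real k / real N)"
  using assms by (simp add: alpha_def cis_conv_exp)

text \<open>The common phase \<open>c\<close> cancels, leaving a geometric sum in an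
  \<open>N\<close>-th root of unity that is 1 only on the diagonal.\<close>

lemma sum_alpha_power:
  assumes i: "i < N" and k: "k < N"
  shows "(\<Sum>m<N. (alpha N c $ i) ^ m * cnj ((alpha N c $ k) ^ m))
    = (if i = k then complex_of_real (real N) else 0)"
proof -
  define z where "z = cis (2 * pi * real k / real N) / cis (2 * pi * real i / real N)"
  have "alpha N c $ i * cnj (alpha N c $ k) = z"
    using i k by (simp add: alpha_nth z_def cis_cnj cis_mult cis_divide)
  then have eq: "(\<Sum>m<N. (alpha N c $ i) ^ m * cnj ((alpha N c $ k) ^ m)) = (\<Sum>m<N. z ^ m)"
    by (simp flip: power_mult_distrib)
  \<comment> \<open>Used twice: injectivity gives \<open>z = 1\<close> only for
    \<open>i = k\<close>, and the range gives \<open>z ^ N = 1\<close>.\<close>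
  have bij: "bij_betw (\<lambda>k. cis (2 * pi * real k / real N)) {..<N} {z. z ^ N = 1}"
    using i by (intro bij_betw_roots_unity) auto
  then have inj: "z = 1 \<longleftrightarrow> i = k"
    using i k by (auto simp: z_def bij_betw_def inj_on_def)
  have "(cis (2 * pi * real j / real N)) ^ N = 1" if "j < N" for j
    using bij that by (auto simp: bij_betw_def)
  then have "z ^ N = 1"
    using i k by (simp add: z_def power_divide)
  then show ?thesis
    using inj unfolding eq by (auto simp: geometric_sum)
qed

section \<open>Unitarity of the basis matrix\<close>

lemma basis_matrix_carrier [simp]: "basis_matrix N \<phi> \<in> carrier_mat N N"
  by (auto simp: basis_matrix_def)

lemma dim_basis_matrix [simp]:
  "dim_row (basis_matrix N \<phi>) = N" "dim_col (basis_matrix N \<phi>) = N"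
  by (auto simp: basis_matrix_def)

lemma basis_matrix_nth [simp]:
  "i < N \<Longrightarrow> j < N \<Longrightarrow> basis_matrix N \<phi> $$ (i, j) = \<phi> j $ i"
  by (simp add: basis_matrix_def mat_of_cols_index)

lemma adjoint_basis_matrix_carrier [simp]:
  "mat_adjoint (basis_matrix N \<phi>) \<in> carrier_mat N N"
  by (auto simp: mat_adjoint_def)

lemma dim_adjoint_basis_matrix [simp]:
  "dim_row (mat_adjoint (basis_matrix N \<phi>)) = N" "dim_col (mat_adjoint (basis_matrix N \<phi>)) = N"
  by (auto simp: mat_adjoint_def)

lemma adjoint_basis_matrix_nth [simp]:
  "i < N \<Longrightarrow> j < N \<Longrightarrow> mat_adjoint (basis_matrix N \<phi>) $$ (i, j) = cnj (\<phi> i $ j)"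
  by (simp add: mat_adjoint_def mat_of_rows_index)

lemma adjoint_mult_basis_matrix:
  assumes "orthonormal_basis N \<phi>"
  shows "mat_adjoint (basis_matrix N \<phi>) * basis_matrix N \<phi> = 1\<^sub>m N"
proof (rule eq_matI)
  fix i j assume "i < dim_row (1\<^sub>m N :: complex mat)" "j < dim_col (1\<^sub>m N :: complex mat)"
  then have ij: "i < N" "j < N" by auto
  then have "\<phi> j \<bullet>c \<phi> i = (if i = j then 1 else 0)" "\<phi> i \<in> carrier_vec N"
    using assms by (auto simp: orthonormal_basis_def)
  then show "(mat_adjoint (basis_matrix N \<phi>) * basis_matrix N \<phi>) $$ (i, j) = 1\<^sub>m N $$ (i, j)"
    using ij by (simp add: scalar_prod_def mult.commute)
qed auto

text \<open>For square matrices a left inverse is also a right inverse.\<close>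

lemma basis_matrix_mult_adjoint:
  assumes "orthonormal_basis N \<phi>"
  shows "basis_matrix N \<phi> * mat_adjoint (basis_matrix N \<phi>) = 1\<^sub>m N"
  using mat_mult_left_right_inverse[OF _ _ adjoint_mult_basis_matrix[OF assms]] by simp

text \<open>The sum over \<open>l\<close> runs through the basis vectors at fixed entries, so
  Parseval there needs orthonormal rows, not columns.\<close>

lemma orthonormal_basis_rows:
  assumes "orthonormal_basis N \<phi>" "i < N" "k < N"
  shows "(\<Sum>l<N. \<phi> l $ i * cnj (\<phi> l $ k)) = (if i = k then 1 else 0)"
proof -
  have "(\<Sum>l<N. \<phi> l $ i * cnj (\<phi> l $ k))
      = (basis_matrix N \<phi> * mat_adjoint (basis_matrix N \<phi>)) $$ (i, k)"
    using assms(2,3) by (simp add: scalar_prod_def lessThan_atLeast0)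
  then show ?thesis
    using assms by (simp add: basis_matrix_mult_adjoint)
qed

lemma fourier_coeffs_carrier [simp]: "fourier_coeffs N \<phi> g \<in> carrier_vec N"
  by (rule carrier_vecI) (simp add: fourier_coeffs_def)

lemma basis_matrix_fourier_coeffs:
  assumes "orthonormal_basis N \<phi>" "g \<in> carrier_vec N"
  shows "basis_matrix N \<phi> *\<^sub>v fourier_coeffs N \<phi> g = g"
  using assms unfolding fourier_coeffs_def
  by (subst assoc_mult_mat_vec[symmetric, of _ N N _ N]) (auto simp: basis_matrix_mult_adjoint)

section \<open>The multiplier in basis coordinates\<close>

lemma multiplier_matrix_carrier [simp]: "multiplier_matrix N \<phi> a \<in> carrier_mat N N"
  by (auto simp: multiplier_matrix_def)

lemma multiplier_matrix_mult_basis_vec: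
  assumes "orthonormal_basis N \<phi>" "x \<in> carrier_vec N"
  shows "multiplier_matrix N \<phi> a *\<^sub>v (basis_matrix N \<phi> *\<^sub>v x)
    = basis_matrix N \<phi> *\<^sub>v vec N (\<lambda>j. a $ j * x $ j)"
proof -
  let ?B = "basis_matrix N \<phi>" and ?D = "mat_diag N (\<lambda>k. a $ k)"
  have "multiplier_matrix N \<phi> a *\<^sub>v (?B *\<^sub>v x) = ?B * ?D * mat_adjoint ?B * ?B *\<^sub>v x"
    unfolding multiplier_matrix_def
    using assms(2) by (intro assoc_mult_mat_vec[symmetric, of _ N N _ N]) (auto intro!: mult_carrier_mat)
  also have "?B * ?D * mat_adjoint ?B * ?B = ?B * ?D"
    by (subst assoc_mult_mat[of _ N N _ N _ N])
      (auto simp: adjoint_mult_basis_matrix[OF assms(1)] intro!: mult_carrier_mat right_mult_one_mat)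
  also have "?B * ?D *\<^sub>v x = ?B *\<^sub>v (?D *\<^sub>v x)"
    using assms(2) by (intro assoc_mult_mat_vec[of _ N N _ N]) auto
  also have "?D *\<^sub>v x = vec N (\<lambda>j. a $ j * x $ j)"
  proof (rule eq_vecI)
    fix i assume "i < dim_vec (vec N (\<lambda>j. a $ j * x $ j))"
    then show "(?D *\<^sub>v x) $ i = vec N (\<lambda>j. a $ j * x $ j) $ i"
      using assms(2) by (simp add: mat_diag_def scalar_prod_def if_distrib[of "\<lambda>t. t * _"] cong: if_cong)
  qed (simp add: mat_diag_def)
  finally show ?thesis .
qed

lemma multiplier_matrix_pow_mult_basis_vec:
  assumes "orthonormal_basis N \<phi>" "x \<in> carrier_vec N"
  shows "(multiplier_matrix N \<phi> a ^\<^sub>m m) *\<^sub>v (basis_matrix N \<phi> *\<^sub>v x)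
    = basis_matrix N \<phi> *\<^sub>v vec N (\<lambda>j. (a $ j) ^ m * x $ j)"
  using assms(2)
proof (induction m arbitrary: x)
  case 0
  then have "vec N (\<lambda>j. (a $ j) ^ 0 * x $ j) = x"
    by (intro eq_vecI) auto
  then show ?case
    \<comment> \<open>The zeroth matrix power is the identity of size \<open>dim_row\<close>, so
      this dimension must be known to be \<open>N\<close>.\<close>
    using 0 carrier_matD(1)[OF multiplier_matrix_carrier, of N \<phi> a]
    by (auto intro!: one_mult_mat_vec mult_mat_vec_carrier[of _ N N])
next
  case (Suc m)
  let ?A = "multiplier_matrix N \<phi> a" and ?B = "basis_matrix N \<phi>"
  \<comment> \<open>The matrix power gains its new factor on the right, so that factor acts on the
    vector first and changes the coordinates \<open>x\<close>; hence the induction generalises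
    \<open>x\<close>.\<close>
  have "(?A ^\<^sub>m Suc m) *\<^sub>v (?B *\<^sub>v x) = (?A ^\<^sub>m m) *\<^sub>v (?A *\<^sub>v (?B *\<^sub>v x))"
    using Suc.prems
    by (auto intro!: assoc_mult_mat_vec[of _ N N _ N] pow_carrier_mat mult_mat_vec_carrier[of _ N N])
  also have "\<dots> = (?A ^\<^sub>m m) *\<^sub>v (?B *\<^sub>v vec N (\<lambda>j. a $ j * x $ j))"
    using Suc.prems by (simp add: multiplier_matrix_mult_basis_vec[OF assms(1)])
  also have "\<dots> = ?B *\<^sub>v vec N (\<lambda>j. (a $ j) ^ m * vec N (\<lambda>j. a $ j * x $ j) $ j)"
    by (rule Suc.IH) simp
  also have "vec N (\<lambda>j. (a $ j) ^ m * vec N (\<lambda>j. a $ j * x $ j) $ j)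
      = vec N (\<lambda>j. (a $ j) ^ Suc m * x $ j)"
    by (intro eq_vecI) (auto simp: mult_ac)
  finally show ?case .
qed

lemma multiplier_matrix_pow_mult_vec_nth:
  assumes "orthonormal_basis N \<phi>" "g \<in> carrier_vec N" "k < N"
  shows "((multiplier_matrix N \<phi> a ^\<^sub>m m) *\<^sub>v g) $ k
    = (\<Sum>j<N. \<phi> j $ k * fourier_coeffs N \<phi> g $ j * (a $ j) ^ m)"
proof -
  have "(multiplier_matrix N \<phi> a ^\<^sub>m m) *\<^sub>v g
      = basis_matrix N \<phi> *\<^sub>v vec N (\<lambda>j. (a $ j) ^ m * fourier_coeffs N \<phi> g $ j)"
    using multiplier_matrix_pow_mult_basis_vec[OF assms(1) fourier_coeffs_carrier, of a m \<phi> g]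
    by (simp add: basis_matrix_fourier_coeffs[OF assms(1,2)])
  then show ?thesis
    using assms(3) by (simp add: scalar_prod_def lessThan_atLeast0 mult_ac)
qed

section \<open>Evaluation of the frame sum\<close>

text \<open>Parseval in \<open>m\<close> at a fixed entry \<open>k\<close>: the coefficients are
  \<open>\<phi> j $ k\<close> times the \<open>j\<close>-th coefficient of \<open>g\<close>, and the
  orthogonal system consists of the powers of \<open>alpha\<close>.\<close>

lemma sum_norm_multiplier_orbit:
  assumes "orthonormal_basis N \<phi>" "g \<in> carrier_vec N" "k < N"
  shows "(\<Sum>m<N. (cmod (((multiplier_matrix N \<phi> (alpha N c) ^\<^sub>m m) *\<^sub>v g) $ k))\<^sup>2)
    = real N * weight N \<phi> g k"
proof -
  have "(\<Sum>m<N. (cmod (\<Sum>j<N. \<phi> j $ k * fourier_coeffs N \<phi> g $ j * (alpha N c $ j) ^ m))\<^sup>2)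
      = real N * (\<Sum>j<N. (cmod (\<phi> j $ k * fourier_coeffs N \<phi> g $ j))\<^sup>2)"
    by (intro parseval_of_orthogonal_rows sum_alpha_power) auto
  then show ?thesis
    using assms by (simp add: multiplier_matrix_pow_mult_vec_nth weight_def norm_mult power_mult_distrib)
qed

lemma sum_norm_cscalar_entrywise_prod:
  assumes "orthonormal_basis N \<phi>" "f \<in> carrier_vec N"
  shows "(\<Sum>l<N. (cmod (f \<bullet>c entrywise_prod (\<phi> l) h))\<^sup>2)
    = (\<Sum>k<N. (cmod (f $ k))\<^sup>2 * (cmod (h $ k))\<^sup>2)"
proof -
  have dim: "dim_vec (\<phi> l) = N" if "l < N" for l
    using assms(1) that by (auto simp: orthonormal_basis_def)
  have "(\<Sum>l<N. (cmod (f \<bullet>c entrywise_prod (\<phi> l) h))\<^sup>2)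
      = (\<Sum>l<N. (cmod (\<Sum>k<N. f $ k * cnj (h $ k) * cnj (\<phi> l $ k)))\<^sup>2)"
    using dim by (intro sum.cong refl)
      (simp add: scalar_prod_def entrywise_prod_def lessThan_atLeast0 mult_ac)
  \<comment> \<open>The factor 1 is the constant \<open>C\<close> of the Parseval lemma. The system
    is the conjugated rows, whose Gram sums are those of the rows with the indices
    exchanged.\<close>
  also have "\<dots> = 1 * (\<Sum>k<N. (cmod (f $ k * cnj (h $ k)))\<^sup>2)"
    using orthonormal_basis_rows[OF assms(1)]
    by (intro parseval_of_orthogonal_rows) (auto simp: mult.commute)
  finally show ?thesis
    by (simp add: norm_mult power_mult_distrib)
qed

lemma frame_sum_eq_weighted:
  assumes "orthonormal_basis N \<phi>" "g \<in> carrier_vec N" "f \<in> carrier_vec N"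
  shows "frame_sum N \<phi> c g f = (\<Sum>k<N. (cmod (f $ k))\<^sup>2 * (real N * weight N \<phi> g k))"
proof -
  let ?h = "\<lambda>m. (multiplier_matrix N \<phi> (alpha N c) ^\<^sub>m m) *\<^sub>v g"
  have "frame_sum N \<phi> c g f = (\<Sum>m<N. \<Sum>k<N. (cmod (f $ k))\<^sup>2 * (cmod (?h m $ k))\<^sup>2)"
    by (simp add: frame_sum_def frame_vec_def sum_norm_cscalar_entrywise_prod[OF assms(1,3)])
  also have "\<dots> = (\<Sum>k<N. (cmod (f $ k))\<^sup>2 * (\<Sum>m<N. (cmod (?h m $ k))\<^sup>2))"
    by (subst sum.swap) (simp add: sum_distrib_left)
  also have "\<dots> = (\<Sum>k<N. (cmod (f $ k))\<^sup>2 * (real N * weight N \<phi> g k))"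
    using assms by (simp add: sum_norm_multiplier_orbit)
  finally show ?thesis .
qed

section \<open>Optimal bounds of the diagonal form\<close>

lemma norm2_vec_power2:
  assumes "f \<in> carrier_vec N"
  shows "(norm2_vec f)\<^sup>2 = (\<Sum>k<N. (cmod (f $ k))\<^sup>2)"
  using assms by (simp add: norm2_vec_def L2_set_def sum_nonneg)

lemma norm2_unit_vec:
  assumes "k < N"
  shows "(norm2_vec (unit_vec N k))\<^sup>2 = 1"
  using assms by (simp add: norm2_vec_power2[of _ N] if_distrib[of "\<lambda>t. (cmod t)\<^sup>2"] cong: if_cong)

lemma frame_sum_unit_vec:
  assumes "orthonormal_basis N \<phi>" "g \<in> carrier_vec N" "k < N"
  shows "frame_sum N \<phi> c g (unit_vec N k) = real N * weight N \<phi> g k"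
  using assms
  by (simp add: frame_sum_eq_weighted if_distrib[of "\<lambda>t. (cmod t)\<^sup>2 * _"] cong: if_cong)

theorem corollary7:
  fixes N :: nat and \<phi> :: "nat \<Rightarrow> complex vec" and g :: "complex vec" and c :: real
  assumes "N \<ge> 1"
    and "orthonormal_basis N \<phi>"
    and "g \<in> carrier_vec N"
    and "0 \<le> c" and "c < 2 * pi"
  shows "(\<forall>f\<in>carrier_vec N.
            lower_const N \<phi> g * (norm2_vec f)\<^sup>2 \<le> frame_sum N \<phi> c g f \<and>
            frame_sum N \<phi> c g f \<le> upper_const N \<phi> g * (norm2_vec f)\<^sup>2)
       \<and> (\<forall>a::real. (\<forall>f\<in>carrier_vec N. a * (norm2_vec f)\<^sup>2 \<le> frame_sum N \<phi> c g f)
            \<longrightarrow> a \<le> lower_const N \<phi> g)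
       \<and> (\<forall>b::real. (\<forall>f\<in>carrier_vec N. frame_sum N \<phi> c g f \<le> b * (norm2_vec f)\<^sup>2)
            \<longrightarrow> upper_const N \<phi> g \<le> b)"
proof (intro conjI ballI allI impI)
  let ?w = "weight N \<phi> g"
  note basis = assms(2) and g = assms(3)
  \<comment> \<open>\<open>N \<ge> 1\<close> makes the set of weights nonempty, so its minimum and
    maximum are attained.\<close>
  have ne: "finite (?w ` {..<N})" "?w ` {..<N} \<noteq> {}"
    using \<open>N \<ge> 1\<close> by (auto simp: lessThan_empty_iff)
  {
    fix f :: "complex vec" assume f: "f \<in> carrier_vec N"
    show "lower_const N \<phi> g * (norm2_vec f)\<^sup>2 \<le> frame_sum N \<phi> c g f"
      \<comment> \<open>Both sides become sums with the factor \<open>(cmod (f $ k))\<^sup>2\<close>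
        in front and are compared term by term.\<close>
      unfolding frame_sum_eq_weighted[OF basis g f] norm2_vec_power2[OF f] lower_const_def
        sum_distrib_left mult.commute[of _ "(cmod _)\<^sup>2"]
      using ne by (intro sum_mono mult_left_mono Min_le) auto
    show "frame_sum N \<phi> c g f \<le> upper_const N \<phi> g * (norm2_vec f)\<^sup>2"
      unfolding frame_sum_eq_weighted[OF basis g f] norm2_vec_power2[OF f] upper_const_def
        sum_distrib_left mult.commute[of _ "(cmod _)\<^sup>2"]
      using ne by (intro sum_mono mult_left_mono Max_ge) auto
  }
  {
    fix a :: real assume *: "\<forall>f\<in>carrier_vec N. a * (norm2_vec f)\<^sup>2 \<le> frame_sum N \<phi> c g f"
    \<comment> \<open>Testing at the standard basis vector of a minimising entry: it has norm 1 and
      its frame sum is exactly the lower constant.\<close>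
    obtain k where k: "k < N" "(MIN k\<in>{..<N}. ?w k) = ?w k"
      using Min_in[OF ne] by auto
    show "a \<le> lower_const N \<phi> g"
      using bspec[OF *, of "unit_vec N k"] k
      by (simp add: norm2_unit_vec frame_sum_unit_vec[OF basis g] lower_const_def)
  }
  {
    fix b :: real assume *: "\<forall>f\<in>carrier_vec N. frame_sum N \<phi> c g f \<le> b * (norm2_vec f)\<^sup>2"
    \<comment> \<open>Likewise at a maximising entry.\<close>
    obtain k where k: "k < N" "(MAX k\<in>{..<N}. ?w k) = ?w k"
      using Max_in[OF ne] by auto
    show "upper_const N \<phi> g \<le> b"
      using bspec[OF *, of "unit_vec N k"] k
      by (simp add: norm2_unit_vec frame_sum_unit_vec[OF basis g] upper_const_def)
  }
qed

end
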